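(* Let $G_2$ be the compact Lie group of algebra automorphisms of the octonions $\mathbb O$, acting by its irreducible $7$-dimensional real representation $\rho$ on $V=\ker\tau_{\mathbb O}=\mathrm{span}_{\mathbb R}\{e_1,\dots,e_7\}$. Let $u=\sum_{i=1}^7e_i\otimes e_i\in V\otimes V$, let $\mathcal A=\mathbb Ru$ with the inner product determined by $\langle u,u\rangle=1$, and let $\tau:\mathcal A\to V\otimes V$ be the inclusion. Then $\tau^*\circ\tau=7\,\mathrm{id}_{\mathcal A}$, the Weingarten map (the Moore–Penrose pseudoinverse of $\tau^*\circ\tau$) is $$\mathrm{Wg}=\tfrac17\,\mathrm{id}_{\mathcal A},$$ and, with $dg$ the normalized Haar measure on $G_2$, for all $1\le i,j\le7$ $$\int_{G_2}\rho^{\otimes2}(g)(e_i\otimes e_j)\,dg=(\tau\circ\mathrm{Wg}\circ\tau^* )(e_i\otimes e_j)=\tfrac17\,\delta_{ij}\sum_{k=1}^7e_k\otimes e_k,$$ or, in matrix coefficients with respect to $e_1,\dots,e_7$, for all $1\le i_1,i_2,j_1,j_2\le 7$ $$\int_{G_2}\rho(g)_{i_1j_1}\,\rho(g)_{i_2j_2}\,dg=\tfrac17\,\delta_{i_1i_2}\,\delta_{j_1j_2}.$$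
   Context: The octonions $\mathbb O$ are the $8$-dimensional real algebra with basis $e_0,\dots,e_7$, unit $e_0$, and $e_ie_j=-\delta_{ij}e_0+\sum_k\psi_{ijk}e_k$ for $i,j\ge1$, where $\psi_{ijk}$ is totally antisymmetric with value $1$ on $(1,2,3),(1,4,7),(1,6,5),(2,4,6),(2,5,7),(3,5,4),(3,6,7)$ and zero on all triples not obtained from these by permutation. $\tau_{\mathbb O}:\mathbb O\to\mathbb R$ is the linear map $\tau_{\mathbb O}(e_i)=\delta_{i0}$, and conjugation is the linear map with $\overline{e_0}=e_0$, $\overline{e_i}=-e_i$ for $i\ge1$. $V$ carries the $G_2$-invariant inner product $B(x,y)=\tau_{\mathbb O}(\overline xy)$, for which $e_1,\dots,e_7$ is an orthonormal basis; $V\otimes V$ carries the induced tensor product inner product, and $\tau^*:V\otimes V\to\mathcal A$ is the adjoint of $\tau$ with respect to it and the chosen inner product on $\mathcal A$. *)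

theory Defs
  imports "HOL-Analysis.Analysis"
begin

section \<open>Octonions\<close>

(* Coordinates are taken with respect to e_0, ..., e_7; the index type 8 has the elements 0, ..., 7.
   The componentwise product that the library puts on real ^ 8 is not used. *)

type_synonym octonion = "real ^ 8"

definition e :: "8 \<Rightarrow> octonion" where
  "e i = axis i 1"

definition oct_triples :: "(8 \<times> 8 \<times> 8) set" where
  "oct_triples = {(1,2,3), (1,4,7), (1,6,5), (2,4,6), (2,5,7), (3,5,4), (3,6,7)}"

definition psi :: "8 \<Rightarrow> 8 \<Rightarrow> 8 \<Rightarrow> real" where
  "psi i j k =
     (if (i,j,k) \<in> oct_triples \<or> (j,k,i) \<in> oct_triples \<or> (k,i,j) \<in> oct_triples then 1
      else if (j,i,k) \<in> oct_triples \<or> (i,k,j) \<in> oct_triples \<or> (k,j,i) \<in> oct_triples then - 1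
      else 0)"

definition basis_mult :: "8 \<Rightarrow> 8 \<Rightarrow> octonion" where
  "basis_mult i j =
     (if i = 0 then e j
      else if j = 0 then e i
      else (if i = j then - e 0 else 0) + (\<Sum>k\<in>UNIV - {0}. psi i j k *\<^sub>R e k))"

definition oct_mult :: "octonion \<Rightarrow> octonion \<Rightarrow> octonion" (infixl "\<odot>" 70) where
  "x \<odot> y = (\<Sum>i\<in>UNIV. \<Sum>j\<in>UNIV. (x $ i * y $ j) *\<^sub>R basis_mult i j)"

definition tau_O :: "octonion \<Rightarrow> real" where
  "tau_O x = x $ 0"

definition oct_cnj :: "octonion \<Rightarrow> octonion" where
  "oct_cnj x = (\<chi> i. if i = 0 then x $ i else - x $ i)"

definition B :: "octonion \<Rightarrow> octonion \<Rightarrow> real" where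
  "B x y = tau_O (oct_cnj x \<odot> y)"

definition V :: "octonion set" where
  "V = {x. tau_O x = 0}"


section \<open>The group and its representation\<close>

(* Endomorphisms of the octonions carry the operator norm topology, and the automorphism group
   the subspace topology. *)

definition G2 :: "(octonion \<Rightarrow>\<^sub>L octonion) set" where
  "G2 = {g. bij (blinfun_apply g) \<and>
            (\<forall>x y. blinfun_apply g (x \<odot> y) = blinfun_apply g x \<odot> blinfun_apply g y)}"

definition rho :: "(octonion \<Rightarrow>\<^sub>L octonion) \<Rightarrow> octonion \<Rightarrow> octonion" where
  "rho g = restrict (blinfun_apply g) V"

(* Regularity is not required separately: a finite Borel measure on a compact metrizable
   space is automatically regular. *)

definition normalized_haar_measure ::
    "'a::topological_space set \<Rightarrow> ('a \<Rightarrow> 'a \<Rightarrow> 'a) \<Rightarrow> 'a measure \<Rightarrow> bool" where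
  "normalized_haar_measure G mul \<mu> \<longleftrightarrow>
     space \<mu> = G \<and>
     sets \<mu> = sets (restrict_space borel G) \<and>
     emeasure \<mu> G = 1 \<and>
     (\<forall>g\<in>G. \<forall>S\<in>sets \<mu>. emeasure \<mu> (mul g ` S) = emeasure \<mu> S)"


section \<open>Tensor products\<close>

(* Coordinate model of the tensor product: e_i \<otimes> e_j is the (i,j)-th standard basis vector. *)

definition tensor :: "real ^ 'm \<Rightarrow> real ^ 'n \<Rightarrow> real ^ ('m \<times> 'n)" (infix "\<otimes>" 75) where
  "x \<otimes> y = (\<chi> p. x $ fst p * y $ snd p)"

type_synonym oct_tensor = "real ^ (8 \<times> 8)"

definition VV :: "oct_tensor set" where
  "VV = span {x \<otimes> y | x y. x \<in> V \<and> y \<in> V}"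

definition VV_inner :: "oct_tensor \<Rightarrow> oct_tensor \<Rightarrow> real" where
  "VV_inner S T =
     (\<Sum>i\<in>UNIV. \<Sum>j\<in>UNIV. \<Sum>k\<in>UNIV. \<Sum>l\<in>UNIV.
        S $ (i, j) * T $ (k, l) * (B (e i) (e k) * B (e j) (e l)))"

definition tensor_square :: "(octonion \<Rightarrow> octonion) \<Rightarrow> oct_tensor \<Rightarrow> oct_tensor" where
  "tensor_square R T =
     (\<Sum>i\<in>UNIV - {0}. \<Sum>j\<in>UNIV - {0}. T $ (i, j) *\<^sub>R (R (e i) \<otimes> R (e j)))"


section \<open>Adjoints and pseudoinverses on subspaces\<close>

(* The inner products are explicit, since the one on the line A below is not the restriction of
   the ambient one. *)

definition adjoint_on ::
    "'a set \<Rightarrow> ('a \<Rightarrow> 'a \<Rightarrow> real) \<Rightarrow> 'b set \<Rightarrow> ('b \<Rightarrow> 'b \<Rightarrow> real) \<Rightarrow> ('a \<Rightarrow> 'b) \<Rightarrow> 'b \<Rightarrow> 'a" where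
  "adjoint_on X p Y q f = (\<lambda>y\<in>Y. THE x'. x' \<in> X \<and> (\<forall>x\<in>X. q (f x) y = p x x'))"

definition selfadjoint_on :: "'a set \<Rightarrow> ('a \<Rightarrow> 'a \<Rightarrow> real) \<Rightarrow> ('a \<Rightarrow> 'a) \<Rightarrow> bool" where
  "selfadjoint_on X p f \<longleftrightarrow> (\<forall>x\<in>X. \<forall>y\<in>X. p (f x) y = p x (f y))"

definition is_moore_penrose ::
    "'a::real_vector set \<Rightarrow> ('a \<Rightarrow> 'a \<Rightarrow> real) \<Rightarrow> ('a \<Rightarrow> 'a) \<Rightarrow> ('a \<Rightarrow> 'a) \<Rightarrow> bool" where
  "is_moore_penrose X p f g \<longleftrightarrow>
     g \<in> X \<rightarrow>\<^sub>E X \<and>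
     (\<forall>x\<in>X. \<forall>y\<in>X. g (x + y) = g x + g y) \<and>
     (\<forall>c. \<forall>x\<in>X. g (c *\<^sub>R x) = c *\<^sub>R g x) \<and>
     (\<forall>x\<in>X. f (g (f x)) = f x) \<and>
     (\<forall>x\<in>X. g (f (g x)) = g x) \<and>
     selfadjoint_on X p (f \<circ> g) \<and>
     selfadjoint_on X p (g \<circ> f)"

definition moore_penrose ::
    "'a::real_vector set \<Rightarrow> ('a \<Rightarrow> 'a \<Rightarrow> real) \<Rightarrow> ('a \<Rightarrow> 'a) \<Rightarrow> 'a \<Rightarrow> 'a" where
  "moore_penrose X p f = (THE g. is_moore_penrose X p f g)"


section \<open>The line of invariants and the Weingarten map\<close>

definition u :: oct_tensor where
  "u = (\<Sum>i\<in>UNIV - {0}. e i \<otimes> e i)"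

definition A :: "oct_tensor set" where
  "A = span {u}"

definition A_inner :: "oct_tensor \<Rightarrow> oct_tensor \<Rightarrow> real" where
  "A_inner a b = (THE r. \<exists>s t. a = s *\<^sub>R u \<and> b = t *\<^sub>R u \<and> r = s * t)"

definition tau :: "oct_tensor \<Rightarrow> oct_tensor" where
  "tau = (\<lambda>a\<in>A. a)"

definition tau_star :: "oct_tensor \<Rightarrow> oct_tensor" where
  "tau_star = adjoint_on A A_inner VV VV_inner tau"

definition Wg :: "oct_tensor \<Rightarrow> oct_tensor" where
  "Wg = moore_penrose A A_inner (tau_star \<circ> tau)"


section \<open>Consistency of the encodings\<close>

lemma V_eq_span: "V = span (e ` (UNIV - {0}))"
proof
  show "V \<subseteq> span (e ` (UNIV - {0}))"
  proof
    fix x assume "x \<in> V"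
    then have x0: "x $ 0 = 0" by (simp add: V_def tau_O_def)
    have "x = (\<Sum>i\<in>UNIV. x $ i *\<^sub>R e i)"
      using basis_expansion[of x] by (simp add: e_def scalar_mult_eq_scaleR)
    also have "\<dots> = (\<Sum>i\<in>UNIV - {0}. x $ i *\<^sub>R e i)"
      by (simp add: sum.remove[of UNIV 0] x0)
    also have "\<dots> \<in> span (e ` (UNIV - {0}))"
      by (intro span_sum span_scale span_base) auto
    finally show "x \<in> span (e ` (UNIV - {0}))" .
  qed
  have "subspace V"
    by (auto simp: subspace_def V_def tau_O_def)
  then show "span (e ` (UNIV - {0})) \<subseteq> V"
    by (intro span_minimal) (auto simp: V_def tau_O_def e_def axis_def)
qed

lemma e_tensor_e: "e i \<otimes> e j = axis (i, j) 1"
  by (auto simp: tensor_def e_def axis_def vec_eq_iff)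

lemma u_in_VV: "u \<in> VV"
  unfolding u_def VV_def
proof (intro span_sum span_base)
  fix i :: 8 assume "i \<in> UNIV - {0}"
  then have "e i \<in> V" by (simp add: V_def tau_O_def e_def axis_def)
  then show "e i \<otimes> e i \<in> {x \<otimes> y | x y. x \<in> V \<and> y \<in> V}" by blast
qed

lemma B_expand: "B x y = (\<Sum>i\<in>UNIV. \<Sum>k\<in>UNIV. x $ i * y $ k * B (e i) (e k))"
proof -
  have c: "oct_cnj x $ i = (if i = 0 then 1 else - 1) * x $ i" for x i
    by (simp add: oct_cnj_def)
  have *: "B x y = (\<Sum>i\<in>UNIV. \<Sum>k\<in>UNIV.
      x $ i * y $ k * ((if i = 0 then 1 else - 1) * basis_mult i k $ 0))" for x y
    by (simp add: B_def tau_O_def oct_mult_def c mult_ac)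
  have "B (e i) (e k) = (if i = 0 then 1 else - 1) * basis_mult i k $ 0" for i k
  proof -
    have "B (e i) (e k) = (\<Sum>i'\<in>UNIV. \<Sum>k'\<in>UNIV. if i' = i \<and> k' = k then
        (if i' = 0 then 1 else - 1) * basis_mult i' k' $ 0 else 0)"
      unfolding * by (intro sum.cong refl) (auto simp: e_def axis_def)
    also have "\<dots> = (\<Sum>i'\<in>UNIV. if i' = i then
        (if i' = 0 then 1 else - 1) * basis_mult i' k $ 0 else 0)"
      by (intro sum.cong refl) (auto simp: sum.delta)
    also have "\<dots> = (if i = 0 then 1 else - 1) * basis_mult i k $ 0"
      by (simp add: sum.delta)
    finally show ?thesis .
  qed
  then show ?thesis
    by (subst *) simp
qed

lemma VV_inner_tensor: "VV_inner (x \<otimes> y) (x' \<otimes> y') = B x x' * B y y'"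
proof -
  let ?f = "\<lambda>i k. x $ i * x' $ k * B (e i) (e k)"
  let ?h = "\<lambda>j l. y $ j * y' $ l * B (e j) (e l)"
  have "VV_inner (x \<otimes> y) (x' \<otimes> y') =
      (\<Sum>i\<in>UNIV. \<Sum>j\<in>UNIV. \<Sum>k\<in>UNIV. \<Sum>l\<in>UNIV. ?f i k * ?h j l)"
    by (simp add: VV_inner_def tensor_def mult_ac)
  also have "\<dots> = (\<Sum>i\<in>UNIV. \<Sum>j\<in>UNIV. (\<Sum>k\<in>UNIV. ?f i k) * (\<Sum>l\<in>UNIV. ?h j l))"
    by (simp only: sum_product)
  also have "\<dots> = B x x' * B y y'"
    by (simp only: sum_product[symmetric] B_expand[symmetric])
  finally show ?thesis .
qed

lemma B_basis: "B (e i) (e j) = (if i = j then 1 else 0)"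
proof -
  have "B (e i) (e j) = (\<Sum>i'\<in>UNIV. \<Sum>j'\<in>UNIV. if i' = i \<and> j' = j then
      (if i' = 0 then 1 else - 1) * basis_mult i' j' $ 0 else 0)"
    unfolding B_def tau_O_def oct_mult_def
    by (simp, intro sum.cong refl) (auto simp: e_def axis_def oct_cnj_def)
  also have "\<dots> = (\<Sum>i'\<in>UNIV. if i' = i then
      (if i' = 0 then 1 else - 1) * basis_mult i' j $ 0 else 0)"
    by (intro sum.cong refl) (auto simp: sum.delta)
  also have "\<dots> = (if i = 0 then 1 else - 1) * basis_mult i j $ 0"
    by (simp add: sum.delta)
  also have "\<dots> = (if i = j then 1 else 0)"
    by (auto simp: basis_mult_def e_def axis_def intro!: sum.neutral)
  finally show ?thesis .
qed

lemma psi_swap: "psi j i k = - psi i j k"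
proof -
  define P where
    "P \<longleftrightarrow> (i,j,k) \<in> oct_triples \<or> (j,k,i) \<in> oct_triples \<or> (k,i,j) \<in> oct_triples"
  define Q where
    "Q \<longleftrightarrow> (j,i,k) \<in> oct_triples \<or> (i,k,j) \<in> oct_triples \<or> (k,j,i) \<in> oct_triples"
  have "\<not> Q" if P
    using that unfolding P_def Q_def oct_triples_def insert_iff empty_iff prod.inject
    by (elim disjE conjE FalseE) (hypsubst, simp)+
  moreover have "psi i j k = (if P then 1 else if Q then - 1 else 0)"
    unfolding psi_def P_def Q_def by (rule refl)
  moreover have "psi j i k = (if Q then 1 else if P then - 1 else 0)"
    unfolding psi_def P_def Q_def by (rule refl)
  ultimately show ?thesis by simp
qed

lemma basis_mult_swap:
  "basis_mult i j + basis_mult j i =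
     (if i = 0 then 2 *\<^sub>R e j else 0) + (if j = 0 then 2 *\<^sub>R e i else 0)
     - (if i = j then 2 *\<^sub>R e 0 else 0)"
proof -
  have "(\<Sum>k\<in>UNIV - {0}. psi i j k *\<^sub>R e k) = - (\<Sum>k\<in>UNIV - {0}. psi j i k *\<^sub>R e k)"
    unfolding sum_negf[symmetric] psi_swap[of i j] by simp
  then show ?thesis
    by (auto simp: basis_mult_def scaleR_2)
qed

lemma oct_square: "y \<odot> y = (2 * y $ 0) *\<^sub>R y - (y \<bullet> y) *\<^sub>R e 0"
proof -
  have y: "y = (\<Sum>j\<in>UNIV. y $ j *\<^sub>R e j)"
    using basis_expansion[of y] by (simp add: e_def scalar_mult_eq_scaleR)
  have d: "(\<Sum>j\<in>UNIV. if i = j then f j else 0) = f i" for i :: 8 and f :: "8 \<Rightarrow> octonion"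
    by (simp add: sum.delta)
  have d': "(\<Sum>j\<in>UNIV. if j = 0 then f j else 0) = f 0" for f :: "8 \<Rightarrow> octonion"
    by (simp add: sum.delta)
  have "2 *\<^sub>R (y \<odot> y) = y \<odot> y + (\<Sum>j\<in>UNIV. \<Sum>i\<in>UNIV. (y $ i * y $ j) *\<^sub>R basis_mult i j)"
    unfolding scaleR_2 oct_mult_def by (subst (2) sum.swap) simp
  also have "\<dots> = (\<Sum>i\<in>UNIV. \<Sum>j\<in>UNIV. (y $ i * y $ j) *\<^sub>R (basis_mult i j + basis_mult j i))"
    by (simp add: oct_mult_def sum.distrib scaleR_add_right mult.commute)
  also have "\<dots> = (\<Sum>i\<in>UNIV. \<Sum>j\<in>UNIV.
        (if i = 0 then (2 * y $ 0 * y $ j) *\<^sub>R e j else 0)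
      + (if j = 0 then (2 * y $ 0 * y $ i) *\<^sub>R e i else 0)
      - (if i = j then (2 * (y $ j * y $ j)) *\<^sub>R e 0 else 0))"
    unfolding basis_mult_swap
    by (intro sum.cong refl) (auto simp: algebra_simps)
  also have "\<dots> = (\<Sum>i\<in>(UNIV::8 set). if i = 0 then (\<Sum>j\<in>UNIV. (2 * y $ 0 * y $ j) *\<^sub>R e j) else 0)
      + (\<Sum>i\<in>UNIV. (2 * y $ 0 * y $ i) *\<^sub>R e i)
      - (\<Sum>i\<in>UNIV. (2 * (y $ i * y $ i)) *\<^sub>R e 0)"
    unfolding sum.distrib sum_subtractf d
    by (intro arg_cong2[of _ _ _ _ "(-)"] arg_cong2[of _ _ _ _ "(+)"] sum.cong refl) (auto simp: d')
  also have "\<dots> = 2 *\<^sub>R ((2 * y $ 0) *\<^sub>R (\<Sum>j\<in>UNIV. y $ j *\<^sub>R e j) - (y \<bullet> y) *\<^sub>R e 0)"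
    unfolding d'
    by (simp add: inner_vec_def scaleR_sum_right scaleR_sum_left scaleR_diff_right
        sum_distrib_left scaleR_2 sum.distrib[symmetric] scaleR_add_left[symmetric] algebra_simps)
  finally show ?thesis using y by simp
qed

lemma e0_unit: "e 0 \<odot> x = x" "x \<odot> e 0 = x"
proof -
  have x: "x = (\<Sum>j\<in>UNIV. x $ j *\<^sub>R e j)"
    using basis_expansion[of x] by (simp add: e_def scalar_mult_eq_scaleR)
  have "e 0 \<odot> x = (\<Sum>i\<in>(UNIV::8 set). if i = 0 then (\<Sum>j\<in>UNIV. x $ j *\<^sub>R e j) else 0)"
    unfolding oct_mult_def
    by (rule sum.cong) (auto simp: basis_mult_def e_def axis_def)
  then show "e 0 \<odot> x = x" using x by (simp add: sum.delta)
  have "(x $ i * e 0 $ j) *\<^sub>R basis_mult i j = (if j = 0 then x $ i *\<^sub>R e i else 0)" for i j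
    by (auto simp: basis_mult_def e_def axis_def)
  then have "x \<odot> e 0 = (\<Sum>i\<in>UNIV. \<Sum>j\<in>(UNIV::8 set). if j = 0 then x $ i *\<^sub>R e i else 0)"
    by (simp only: oct_mult_def)
  then show "x \<odot> e 0 = x" using x by (simp add: sum.delta)
qed

lemma G2_unit:
  assumes "g \<in> G2"
  shows "blinfun_apply g (e 0) = e 0"
proof -
  obtain z where z: "e 0 = blinfun_apply g z"
    using assms unfolding G2_def by (metis (no_types, lifting) bij_pointE mem_Collect_eq)
  have "blinfun_apply g (e 0) = blinfun_apply g (e 0) \<odot> blinfun_apply g z"
    by (simp flip: z add: e0_unit)
  also have "\<dots> = blinfun_apply g (e 0 \<odot> z)"
    using assms by (simp add: G2_def)
  finally have "blinfun_apply g (e 0) = blinfun_apply g z"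
    by (simp only: e0_unit)
  then show ?thesis using z by simp
qed

lemma rho_in_V:
  assumes g: "g \<in> G2" and x: "x \<in> V"
  shows "rho g x \<in> V"
proof -
  define y where "y = blinfun_apply g x"
  have x0: "x $ 0 = 0" using x by (simp add: V_def tau_O_def)
  have "y \<odot> y = blinfun_apply g (x \<odot> x)"
    using g by (simp add: G2_def y_def)
  also have "\<dots> = - (x \<bullet> x) *\<^sub>R e 0"
    by (simp add: oct_square x0 blinfun.minus_right blinfun.scaleR_right G2_unit[OF g])
  finally have "(2 * y $ 0) *\<^sub>R y = (y \<bullet> y - x \<bullet> x) *\<^sub>R e 0"
    by (simp add: oct_square[of y] algebra_simps)
  moreover have "y $ 0 = 0" if eq: "y = c *\<^sub>R e 0" for c
  proof -
    have "blinfun_apply g x = blinfun_apply g (c *\<^sub>R e 0)"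
      using eq by (simp add: y_def blinfun.scaleR_right G2_unit[OF g])
    then have "x = c *\<^sub>R e 0"
      using g by (auto simp: G2_def bij_def dest: injD)
    then have "c = 0" using x0 by (auto simp: e_def axis_def)
    then show ?thesis using eq by simp
  qed
  ultimately have "y $ 0 = 0"
    by (metis (no_types, lifting) divide_inverse_commute divideR_right mult_eq_0_iff
        scaleR_scaleR zero_neq_numeral)
  then show ?thesis using x by (simp add: rho_def V_def tau_O_def y_def)
qed

lemma tensor_square_tensor:
  assumes g: "g \<in> G2" and x: "x \<in> V" and y: "y \<in> V"
  shows "tensor_square (rho g) (x \<otimes> y) = rho g x \<otimes> rho g y"
proof -
  have ex: "rho g x $ k = (\<Sum>i\<in>UNIV - {0}. x $ i * rho g (e i) $ k)" if x: "x \<in> V" for x k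
  proof -
    have eV: "e i \<in> V" if "i \<noteq> 0" for i
      using that by (simp add: V_def tau_O_def e_def axis_def)
    have "x = (\<Sum>i\<in>UNIV. x $ i *\<^sub>R e i)"
      using basis_expansion[of x] by (simp add: e_def scalar_mult_eq_scaleR)
    also have "\<dots> = (\<Sum>i\<in>UNIV - {0}. x $ i *\<^sub>R e i)"
      using x by (simp add: sum.remove[of UNIV 0] V_def tau_O_def)
    finally have "blinfun_apply g x = (\<Sum>i\<in>UNIV - {0}. x $ i *\<^sub>R blinfun_apply g (e i))"
      by (metis (no_types, lifting) blinfun.scaleR_right blinfun.sum_right sum.cong)
    then show ?thesis
      using x eV by (simp add: rho_def)
  qed
  show ?thesis
    by (simp add: vec_eq_iff tensor_square_def tensor_def ex[OF x] ex[OF y] sum_product mult_ac)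
qed

end

(* For fixed j1, j2 the matrix M(i1,i2) of integrals of g(i1,j1) g(i2,j2) commutes with every
   h in G2, by left invariance. Two kinds of elements of G2 force it to be scalar: sign changes,
   coming from the grading of the octonions by (Z/2)^3, kill the off-diagonal entries, and an
   automorphism permuting e_1, ..., e_7 cyclically makes the diagonal entries equal. Since G2
   preserves the inner product on V, the trace of M is 1 if j1 = j2 and 0 otherwise. *)

theory Submission
  imports Defs
begin

section \<open>Automorphisms permuting the basis up to sign\<close>

lemma e_nth: "e i $ j = (if j = i then 1 else 0)"
  by (simp add: e_def axis_def)

lemma UNIV_8: "(UNIV :: 8 set) = {0, 1, 2, 3, 4, 5, 6, 7}"
  by (rule sym, rule card_subset_eq) auto

definition signed_perm :: "(8 \<Rightarrow> 8) \<Rightarrow> (8 \<Rightarrow> real) \<Rightarrow> octonion \<Rightarrow>\<^sub>L octonion" where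
  "signed_perm \<sigma> s = Blinfun (\<lambda>x. \<Sum>i\<in>UNIV. (s i * x $ i) *\<^sub>R e (\<sigma> i))"

lemma signed_perm_apply:
  "blinfun_apply (signed_perm \<sigma> s) x = (\<Sum>i\<in>UNIV. (s i * x $ i) *\<^sub>R e (\<sigma> i))"
proof -
  have "linear (\<lambda>x::octonion. \<Sum>i\<in>UNIV. (s i * x $ i) *\<^sub>R e (\<sigma> i))"
    by (rule linearI) (simp_all add: algebra_simps sum.distrib scaleR_sum_right)
  then show ?thesis
    by (simp add: signed_perm_def bounded_linear_Blinfun_apply linear_linear)
qed

lemma signed_perm_basis: "blinfun_apply (signed_perm \<sigma> s) (e i) = s i *\<^sub>R e (\<sigma> i)"
proof -
  have "(s j * e i $ j) *\<^sub>R e (\<sigma> j) = (if j = i then s i *\<^sub>R e (\<sigma> i) else 0)" for j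
    by (simp add: e_nth)
  then show ?thesis
    by (simp add: signed_perm_apply)
qed

text \<open>Reading the coordinate at \<open>\<sigma> i\<close> avoids the inverse permutation; by
  injectivity only the summand of index \<open>i\<close> contributes.\<close>

lemma signed_perm_nth:
  assumes "inj \<sigma>"
  shows "blinfun_apply (signed_perm \<sigma> s) x $ \<sigma> i = s i * x $ i"
proof -
  have "(s j * x $ j) * e (\<sigma> j) $ \<sigma> i = (if j = i then s i * x $ i else 0)" for j
    using assms by (auto simp: e_nth inj_eq)
  then show ?thesis
    by (simp add: signed_perm_apply)
qed

text \<open>The condition on \<open>psi\<close> says that the structure constants are preserved up
  to the signs of the three basis vectors, which is multiplicativity on basis vectors.\<close>

lemma signed_perm_basis_mult:
  assumes \<sigma>: "inj \<sigma>" "\<sigma> 0 = 0" and s: "\<And>i. s i * s i = 1" "s 0 = 1"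
    and psi: "\<And>i j k. psi (\<sigma> i) (\<sigma> j) (\<sigma> k) = s i * s j * s k * psi i j k"
  shows "blinfun_apply (signed_perm \<sigma> s) (basis_mult i j) =
    (s i * s j) *\<^sub>R basis_mult (\<sigma> i) (\<sigma> j)"
proof -
  have \<sigma>0: "\<sigma> i = 0 \<longleftrightarrow> i = 0" for i
    using \<sigma> by (metis injD)
  have im: "\<sigma> ` (UNIV - {0}) = UNIV - {0}"
    using \<sigma> finite_UNIV_inj_surj[of \<sigma>] by (simp add: image_set_diff)
  have "(\<Sum>k\<in>UNIV - {0}. psi (\<sigma> i) (\<sigma> j) k *\<^sub>R e k) =
      (\<Sum>k\<in>UNIV - {0}. psi (\<sigma> i) (\<sigma> j) (\<sigma> k) *\<^sub>R e (\<sigma> k))"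
    using sum.reindex[of \<sigma> "UNIV - {0}" "\<lambda>k. psi (\<sigma> i) (\<sigma> j) k *\<^sub>R e k"] \<sigma>(1)
    by (simp add: im inj_on_def inj_def)
  \<comment> \<open>The signs of \<open>i\<close> and \<open>j\<close> occur twice and cancel,
    leaving the sign that the map gives to \<open>e k\<close>.\<close>
  moreover have "s i * s j * (s i * s j * s k * psi i j k) = psi i j k * s k" for k
    using s(1)[of i] s(1)[of j] by algebra
  ultimately have "(s i * s j) *\<^sub>R (\<Sum>k\<in>UNIV - {0}. psi (\<sigma> i) (\<sigma> j) k *\<^sub>R e k) =
      (\<Sum>k\<in>UNIV - {0}. psi i j k *\<^sub>R s k *\<^sub>R e (\<sigma> k))"
    by (simp only: psi scaleR_sum_right scaleR_scaleR)
  then show ?thesis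
    using \<sigma>(1) s
    by (auto simp: basis_mult_def \<sigma> \<sigma>0 signed_perm_basis blinfun.add_right blinfun.sum_right
        blinfun.scaleR_right blinfun.minus_right scaleR_add_right inj_eq)
qed

text \<open>Reindexing both sums of the product along \<open>\<sigma>\<close> makes a product of two
  images comparable, term by term, with the image of a product.\<close>

lemma oct_mult_sums:
  fixes \<sigma> :: "8 \<Rightarrow> 8"
  assumes "bij \<sigma>"
  shows "(\<Sum>i\<in>UNIV. x i *\<^sub>R e (\<sigma> i)) \<odot> (\<Sum>j\<in>UNIV. y j *\<^sub>R e (\<sigma> j)) =
    (\<Sum>i\<in>UNIV. \<Sum>j\<in>UNIV. (x i * y j) *\<^sub>R basis_mult (\<sigma> i) (\<sigma> j))"
proof -
  have nth: "(\<Sum>i\<in>UNIV. z i *\<^sub>R e (\<sigma> i)) $ \<sigma> k = z k" for z k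
  proof -
    have "z i * e (\<sigma> i) $ \<sigma> k = (if i = k then z k else 0)" for i
      using assms by (auto simp: e_nth bij_def inj_eq)
    then show ?thesis by simp
  qed
  have "X \<odot> Y = (\<Sum>i\<in>UNIV. \<Sum>j\<in>UNIV. (X $ \<sigma> i * Y $ \<sigma> j) *\<^sub>R basis_mult (\<sigma> i) (\<sigma> j))" for X Y
    unfolding oct_mult_def
    by (rule trans[OF sum.reindex_bij_betw[OF assms, symmetric]])
      (intro sum.cong refl sum.reindex_bij_betw[OF assms, symmetric])
  then show ?thesis
    by (simp only: nth)
qed

lemma signed_perm_in_G2:
  assumes \<sigma>: "inj \<sigma>" "\<sigma> 0 = 0" and s: "\<And>i. s i * s i = 1" "s 0 = 1"
    and psi: "\<And>i j k. psi (\<sigma> i) (\<sigma> j) (\<sigma> k) = s i * s j * s k * psi i j k"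
  shows "signed_perm \<sigma> s \<in> G2"
proof -
  let ?h = "blinfun_apply (signed_perm \<sigma> s)"
  have bij: "bij \<sigma>"
    using \<sigma>(1) by (simp add: bij_def finite_UNIV_inj_surj)
  have s0: "s i \<noteq> 0" for i
    using s(1)[of i] by auto
  have "inj ?h"
  proof (rule injI)
    fix x y assume "?h x = ?h y"
    then have "s i * x $ i = s i * y $ i" for i
      by (metis \<sigma>(1) signed_perm_nth)
    then show "x = y"
      using s0 by (simp add: vec_eq_iff)
  qed
  then have "bij ?h"
    using linear_inj_imp_surj[OF bounded_linear.linear[OF blinfun.bounded_linear_right]]
    by (simp add: bij_def)
  moreover have "?h (x \<odot> y) = ?h x \<odot> ?h y" for x y
  proof -
    have "?h (x \<odot> y) = (\<Sum>i\<in>UNIV. \<Sum>j\<in>UNIV. (x $ i * y $ j) *\<^sub>R ?h (basis_mult i j))"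
      by (simp add: oct_mult_def blinfun.sum_right blinfun.scaleR_right)
    also have "\<dots> = (\<Sum>i\<in>UNIV. \<Sum>j\<in>UNIV. (s i * x $ i * (s j * y $ j)) *\<^sub>R basis_mult (\<sigma> i) (\<sigma> j))"
      by (simp add: signed_perm_basis_mult[OF assms] mult_ac)
    also have "\<dots> = ?h x \<odot> ?h y"
      by (simp add: signed_perm_apply oct_mult_sums[OF bij])
    finally show ?thesis .
  qed
  ultimately show ?thesis
    by (simp add: G2_def)
qed

section \<open>Symmetries of the oriented Fano plane\<close>

definition sign_change :: "8 set \<Rightarrow> 8 \<Rightarrow> real" where
  "sign_change N i = (if i \<in> N then - 1 else 1)"

(* The three sets are the complements of the lines 123, 147, 246 of the Fano plane. *)
lemma sign_change_in_G2:
  assumes N: "N = {4, 5, 6, 7} \<or> N = {2, 3, 5, 6} \<or> N = {1, 3, 5, 7}"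
  shows "signed_perm id (sign_change N) \<in> G2"
proof (rule signed_perm_in_G2)
  \<comment> \<open>A line of the Fano plane misses its own complement and meets the complement of
    any other line in two points, so the number of minus signs is even.\<close>
  have "\<forall>(i, j, k)\<in>oct_triples. sign_change N i * sign_change N j * sign_change N k = 1"
    using N by (elim disjE) (simp_all add: oct_triples_def sign_change_def)
  then have T: "sign_change N i * sign_change N j * sign_change N k = 1"
    if "(i, j, k) \<in> oct_triples" for i j k
    using that by blast
  show "psi (id i) (id j) (id k) = sign_change N i * sign_change N j * sign_change N k * psi i j k"
    for i j k
  proof (cases "psi i j k = 0")
    case False
    then have "(i,j,k) \<in> oct_triples \<or> (j,k,i) \<in> oct_triples \<or> (k,i,j) \<in> oct_triples \<or>
        (j,i,k) \<in> oct_triples \<or> (i,k,j) \<in> oct_triples \<or> (k,j,i) \<in> oct_triples"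
      unfolding psi_def by presburger
    then have "sign_change N i * sign_change N j * sign_change N k = 1"
      by (auto dest!: T simp: mult_ac)
    then show ?thesis by simp
  qed simp
  show "sign_change N 0 = 1"
    using N by (auto simp: sign_change_def)
qed (simp_all add: sign_change_def)

text \<open>A cyclic collineation of the Fano plane. Up to rotation it moves the oriented lines
  along 123, 246, 354, 367, 165, 257, 147 and back to 123.\<close>

definition cycle7 :: "8 \<Rightarrow> 8" where
  "cycle7 = id(1 := 2, 2 := 4, 4 := 3, 3 := 6, 6 := 5, 5 := 7, 7 := 1)"

lemma cycle7_simps:
  "cycle7 0 = 0" "cycle7 1 = 2" "cycle7 2 = 4" "cycle7 4 = 3" "cycle7 3 = 6"
  "cycle7 6 = 5" "cycle7 5 = 7" "cycle7 7 = 1"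
  by (simp_all add: cycle7_def)

lemma inj_cycle7: "inj cycle7"
proof -
  have "surj cycle7"
    unfolding UNIV_8 image_insert image_empty cycle7_simps by blast
  then show ?thesis
    by (simp add: finite_UNIV_surj_inj)
qed

lemma cycle7_in_G2: "signed_perm cycle7 (\<lambda>_. 1) \<in> G2"
proof (rule signed_perm_in_G2)
  (* This cycle preserves the oriented triples up to rotation, so that no signs are needed. *)
  define C where "C = oct_triples \<union> (\<lambda>(i, j, k). (j, k, i)) ` oct_triples
    \<union> (\<lambda>(i, j, k). (k, i, j)) ` oct_triples"
  let ?f = "map_prod cycle7 (map_prod cycle7 cycle7)"
  have f: "inj ?f"
    by (intro prod.inj_map inj_cycle7)
  have "finite C"
    by (simp add: C_def oct_triples_def)
  moreover have "?f ` C \<subseteq> C"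
    by (simp add: C_def oct_triples_def cycle7_simps)
  \<comment> \<open>An injective self-map of a finite set is onto, so membership in \<open>C\<close>
    is reflected as well as preserved.\<close>
  ultimately have "?f ` C = C"
    using f by (meson endo_inj_surj inj_on_subset subset_UNIV)
  then have "(cycle7 i, cycle7 j, cycle7 k) \<in> C \<longleftrightarrow> (i, j, k) \<in> C" for i j k
    using inj_image_mem_iff[OF f, of "(i, j, k)" C] by simp
  moreover have "(i, j, k) \<in> C \<longleftrightarrow>
      (i, j, k) \<in> oct_triples \<or> (j, k, i) \<in> oct_triples \<or> (k, i, j) \<in> oct_triples" for i j k
    by (auto simp: C_def intro: rev_image_eqI)
  \<comment> \<open>\<open>C\<close> absorbs the rotations: the sign of \<open>psi\<close> depends
    only on which of the two orientations lies in \<open>C\<close>.\<close>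
  then have "psi i j k = (if (i, j, k) \<in> C then 1 else if (j, i, k) \<in> C then - 1 else 0)"
    for i j k
    by (simp add: psi_def)
  ultimately show "psi (cycle7 i) (cycle7 j) (cycle7 k) = 1 * 1 * 1 * psi i j k" for i j k
    by simp
qed (simp_all add: inj_cycle7 cycle7_simps)


section \<open>Invariance of the matrix coefficients under the Haar measure\<close>

lemma G2_compose: "g \<in> G2 \<Longrightarrow> h \<in> G2 \<Longrightarrow> g o\<^sub>L h \<in> G2"
  using bij_comp[of "blinfun_apply h" "blinfun_apply g"]
  by (auto simp: G2_def blinfun_compose.rep_eq)

text \<open>The set-theoretic inverse is linear, hence bounded in finite dimension, and inherits
  multiplicativity through the injectivity of \<open>g\<close>.\<close>

lemma G2_inverse:
  assumes "g \<in> G2"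
  obtains g' where "g' \<in> G2" "g o\<^sub>L g' = id_blinfun" "g' o\<^sub>L g = id_blinfun"
proof -
  let ?i = "inv (blinfun_apply g)"
  have bij: "bij (blinfun_apply g)"
    and mult: "blinfun_apply g (x \<odot> y) = blinfun_apply g x \<odot> blinfun_apply g y" for x y
    using assms by (simp_all add: G2_def)
  have inv: "blinfun_apply g (?i x) = x" "?i (blinfun_apply g x) = x" for x
    using bij by (simp_all add: bij_def surj_f_inv_f)
  have inj: "x = y" if "blinfun_apply g x = blinfun_apply g y" for x y
    using that bij by (auto simp: bij_def dest: injD)
  have "linear ?i"
    by (intro linearI; rule inj) (simp_all add: inv blinfun.add_right blinfun.scaleR_right)
  then have app: "blinfun_apply (Blinfun ?i) = ?i"
    by (simp add: bounded_linear_Blinfun_apply linear_linear)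
  have "?i (x \<odot> y) = ?i x \<odot> ?i y" for x y
    by (rule inj) (simp add: inv mult)
  then have "Blinfun ?i \<in> G2"
    using bij by (simp add: G2_def app bij_imp_bij_inv)
  then show ?thesis
    by (rule that) (auto intro!: blinfun_eqI simp: app inv)
qed

text \<open>The measurable sets are the traces of Borel sets on \<open>G2\<close>, so continuity on
  the whole operator space suffices, both for translations and for matrix coefficients.\<close>

lemma measurable_haar:
  assumes "normalized_haar_measure G2 (o\<^sub>L) \<mu>" and "continuous_on UNIV f"
  shows "f \<in> borel_measurable \<mu>"
proof -
  have "f \<in> borel_measurable (restrict_space borel G2)"
    using assms(2) by (intro measurable_restrict_space1 borel_measurable_continuous_onI)
  moreover have "sets \<mu> = sets (restrict_space borel G2)"
    using assms(1) by (simp add: normalized_haar_measure_def)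
  ultimately show ?thesis
    using measurable_cong_sets by blast
qed

text \<open>Haar invariance is stated for images, whereas \<open>distr\<close> uses preimages; the
  two agree because left translation is onto \<open>G2\<close>.\<close>

lemma haar_distr_left_mult:
  assumes haar: "normalized_haar_measure G2 (o\<^sub>L) \<mu>" and h: "h \<in> G2"
  shows "(o\<^sub>L) h \<in> measurable \<mu> \<mu>" and "distr \<mu> \<mu> ((o\<^sub>L) h) = \<mu>"
proof -
  have space: "space \<mu> = G2" and sets: "sets \<mu> = sets (restrict_space borel G2)"
    and inv: "\<And>g S. g \<in> G2 \<Longrightarrow> S \<in> sets \<mu> \<Longrightarrow> emeasure \<mu> ((o\<^sub>L) g ` S) = emeasure \<mu> S"
    using haar by (simp_all add: normalized_haar_measure_def)
  have "(o\<^sub>L) h \<in> measurable \<mu> (restrict_space borel G2)"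
    by (rule measurable_restrict_space2)
      (auto simp: space G2_compose h intro!: measurable_haar[OF haar] continuous_intros)
  then show meas: "(o\<^sub>L) h \<in> measurable \<mu> \<mu>"
    using measurable_cong_sets[OF refl sets] by blast
  obtain h' where h': "h' \<in> G2" "h o\<^sub>L h' = id_blinfun"
    using G2_inverse[OF h] by blast
  show "distr \<mu> \<mu> ((o\<^sub>L) h) = \<mu>"
  proof (rule measure_eqI)
    fix S assume "S \<in> sets (distr \<mu> \<mu> ((o\<^sub>L) h))"
    then have S: "S \<in> sets \<mu>" by simp
    let ?P = "(o\<^sub>L) h -` S \<inter> space \<mu>"
    have P: "?P \<in> sets \<mu>"
      using meas S by (rule measurable_sets)
    have "S \<subseteq> (o\<^sub>L) h ` ?P"
    proof
      fix g assume g: "g \<in> S"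
      then have "g \<in> G2"
        using S sets.sets_into_space space by blast
      \<comment> \<open>The preimage of \<open>g\<close> under left translation by \<open>h\<close>
        is \<open>h' o\<^sub>L g\<close>.\<close>
      moreover have "g = h o\<^sub>L (h' o\<^sub>L g)"
        using arg_cong[OF h'(2), of blinfun_apply] by (intro blinfun_eqI) (simp add: fun_eq_iff)
      ultimately show "g \<in> (o\<^sub>L) h ` ?P"
        using g h' by (intro image_eqI[of _ _ "h' o\<^sub>L g"]) (auto simp: space G2_compose)
    qed
    then have "(o\<^sub>L) h ` ?P = S" by blast
    then show "emeasure (distr \<mu> \<mu> ((o\<^sub>L) h)) S = emeasure \<mu> S"
      using inv[OF h P] meas S by (simp add: emeasure_distr)
  qed simp
qed

section \<open>Orthogonality of the action on V\<close>

lemma G2_nth_0: "g \<in> G2 \<Longrightarrow> x $ 0 = 0 \<Longrightarrow> blinfun_apply g x $ 0 = 0"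
  using rho_in_V[of g x] by (simp add: rho_def V_def tau_O_def)

text \<open>The square of an imaginary octonion is minus its squared norm times \<open>e 0\<close>,
  and \<open>g\<close> preserves squares, imaginary octonions and \<open>e 0\<close>.\<close>

lemma G2_inner_self:
  assumes g: "g \<in> G2" and x: "x $ 0 = 0"
  shows "blinfun_apply g x \<bullet> blinfun_apply g x = x \<bullet> x"
proof -
  have "blinfun_apply g x \<odot> blinfun_apply g x = blinfun_apply g (x \<odot> x)"
    using g by (simp add: G2_def)
  also have "\<dots> = - (x \<bullet> x) *\<^sub>R e 0"
    by (simp add: oct_square x blinfun.minus_right blinfun.scaleR_right G2_unit[OF g])
  finally have "(blinfun_apply g x \<bullet> blinfun_apply g x) *\<^sub>R e 0 = (x \<bullet> x) *\<^sub>R e 0"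
    by (simp add: oct_square[of "blinfun_apply g x"] G2_nth_0[OF g x])
  then show ?thesis
    by (auto simp: e_def axis_def vec_eq_iff dest: spec[of _ 0])
qed

text \<open>Polarization of \<open>G2_inner_self\<close>.\<close>

lemma G2_inner:
  assumes g: "g \<in> G2" and x: "x $ 0 = 0" and y: "y $ 0 = 0"
  shows "blinfun_apply g x \<bullet> blinfun_apply g y = x \<bullet> y"
  using G2_inner_self[OF g x] G2_inner_self[OF g y] G2_inner_self[OF g, of "x + y"] x y
  by (simp add: blinfun.add_right inner_add_left inner_add_right inner_commute)

lemma G2_coeff_le_1:
  assumes "g \<in> G2" "j \<noteq> 0"
  shows "\<bar>blinfun_apply g (e j) $ i\<bar> \<le> 1"
proof -
  have "e j \<bullet> e j = 1"
    by (simp add: e_def inner_axis_axis)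
  then have "norm (blinfun_apply g (e j)) = 1"
    using G2_inner_self[OF assms(1), of "e j"] assms(2) by (simp add: e_nth norm_eq_sqrt_inner)
  then show ?thesis
    using component_le_norm_cart[of "blinfun_apply g (e j)" i] by simp
qed

section \<open>Second moments of the matrix coefficients\<close>

definition coeff2 :: "8 \<Rightarrow> 8 \<Rightarrow> 8 \<Rightarrow> 8 \<Rightarrow> (octonion \<Rightarrow>\<^sub>L octonion) \<Rightarrow> real" where
  "coeff2 i1 i2 j1 j2 g = blinfun_apply g (e j1) $ i1 * blinfun_apply g (e j2) $ i2"

lemma coeff2_measurable:
  assumes "normalized_haar_measure G2 (o\<^sub>L) \<mu>"
  shows "coeff2 i1 i2 j1 j2 \<in> borel_measurable \<mu>"
  unfolding coeff2_def by (intro measurable_haar[OF assms] continuous_intros)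

text \<open>The columns of \<open>g\<close> with nonzero index are unit vectors, so the integrand is
  bounded by 1 on a space of finite measure.\<close>

lemma coeff2_integrable:
  assumes haar: "normalized_haar_measure G2 (o\<^sub>L) \<mu>" and j: "j1 \<noteq> 0" "j2 \<noteq> 0"
  shows "integrable \<mu> (coeff2 i1 i2 j1 j2)"
proof -
  interpret finite_measure \<mu>
    using haar by (intro finite_measureI) (simp add: normalized_haar_measure_def)
  show ?thesis
  proof (rule integrable_const_bound[OF _ coeff2_measurable[OF haar]])
    show "AE g in \<mu>. norm (coeff2 i1 i2 j1 j2 g) \<le> 1"
    proof (rule AE_I2)
      fix g assume "g \<in> space \<mu>"
      then have "g \<in> G2"
        using haar by (simp add: normalized_haar_measure_def)
      then show "norm (coeff2 i1 i2 j1 j2 g) \<le> 1"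
        using j by (simp add: coeff2_def abs_mult mult_le_one G2_coeff_le_1)
    qed
  qed
qed

text \<open>Left translation by a signed permutation permutes the rows of \<open>g\<close> up to
  sign and leaves the column indices alone.\<close>

lemma integral_coeff2_signed_perm:
  assumes haar: "normalized_haar_measure G2 (o\<^sub>L) \<mu>"
    and h: "signed_perm \<sigma> s \<in> G2" "inj \<sigma>"
  shows "integral\<^sup>L \<mu> (coeff2 (\<sigma> i1) (\<sigma> i2) j1 j2) =
    s i1 * s i2 * integral\<^sup>L \<mu> (coeff2 i1 i2 j1 j2)"
proof -
  let ?T = "(o\<^sub>L) (signed_perm \<sigma> s)"
  let ?f = "coeff2 (\<sigma> i1) (\<sigma> i2) j1 j2"
  have "integral\<^sup>L \<mu> ?f = integral\<^sup>L (distr \<mu> \<mu> ?T) ?f"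
    by (simp add: haar_distr_left_mult(2)[OF haar h(1)])
  also have "\<dots> = (\<integral>g. ?f (?T g) \<partial>\<mu>)"
    by (rule integral_distr[OF haar_distr_left_mult(1)[OF haar h(1)] coeff2_measurable[OF haar]])
  also have "\<dots> = (\<integral>g. s i1 * s i2 * coeff2 i1 i2 j1 j2 g \<partial>\<mu>)"
    by (intro Bochner_Integration.integral_cong refl)
      (simp add: coeff2_def signed_perm_nth[OF h(2)] mult_ac)
  finally show ?thesis by simp
qed

text \<open>Membership in the three sets sends 1, ..., 7 bijectively to the nonzero vectors of
  (Z/2)^3, so distinct indices differ in some component.\<close>

lemma sign_sets_separate:
  fixes i j :: 8
  assumes "i \<in> {1, 2, 3, 4, 5, 6, 7}" "j \<in> {1, 2, 3, 4, 5, 6, 7}" "i \<noteq> j"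
  shows "\<exists>N\<in>{{4, 5, 6, 7}, {2, 3, 5, 6}, {1, 3, 5, 7}}. (i \<in> N) \<noteq> (j \<in> N)"
  using assms
  by (simp only: insert_iff empty_iff bex_simps simp_thms, elim disjE)
    (simp_all only: simp_thms, simp_all)

text \<open>A sign change that separates \<open>i1\<close> from \<open>i2\<close> shows that the
  integral equals its own negative.\<close>

lemma integral_coeff2_off_diagonal:
  assumes haar: "normalized_haar_measure G2 (o\<^sub>L) \<mu>"
    and i: "i1 \<noteq> 0" "i2 \<noteq> 0" "i1 \<noteq> i2"
  shows "integral\<^sup>L \<mu> (coeff2 i1 i2 j1 j2) = 0"
proof -
  have "i1 \<in> {1, 2, 3, 4, 5, 6, 7}" "i2 \<in> {1, 2, 3, 4, 5, 6, 7}"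
    using i UNIV_8 by auto
  then have "\<exists>N\<in>{{4, 5, 6, 7}, {2, 3, 5, 6}, {1, 3, 5, 7}}. (i1 \<in> N) \<noteq> (i2 \<in> N)"
    using i(3) by (rule sign_sets_separate)
  then obtain N where N: "N = {4, 5, 6, 7} \<or> N = {2, 3, 5, 6} \<or> N = {1, 3, 5, 7}"
    and neq: "(i1 \<in> N) \<noteq> (i2 \<in> N)" by blast
  have "sign_change N i1 * sign_change N i2 = - 1"
    using neq by (auto simp: sign_change_def)
  then show ?thesis
    using integral_coeff2_signed_perm[OF haar sign_change_in_G2[OF N], of i1 i2 j1 j2] by simp
qed

lemma integral_coeff2_diagonal:
  assumes haar: "normalized_haar_measure G2 (o\<^sub>L) \<mu>"
    and i: "i \<noteq> 0" and j: "j1 \<noteq> 0" "j2 \<noteq> 0"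
  shows "integral\<^sup>L \<mu> (coeff2 i i j1 j2) = 1/7 * (if j1 = j2 then 1 else 0)"
proof -
  define M where "M i = integral\<^sup>L \<mu> (coeff2 i i j1 j2)" for i
  have step: "M (cycle7 i) = M i" for i
    using integral_coeff2_signed_perm[OF haar cycle7_in_G2 inj_cycle7] by (simp add: M_def)
  \<comment> \<open>Six steps along the orbit 1, 2, 4, 3, 6, 5, 7 reach every nonzero index.\<close>
  have const: "M 2 = M 1" "M 3 = M 1" "M 4 = M 1" "M 5 = M 1" "M 6 = M 1" "M 7 = M 1"
    using step[of 1] step[of 2] step[of 4] step[of 3] step[of 6] step[of 5]
    by (simp_all add: cycle7_simps)
  have M: "M i = M 1" if "i \<noteq> 0" for i
  proof -
    have "i \<in> {0, 1, 2, 3, 4, 5, 6, 7}"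
      by (simp only: UNIV_8[symmetric] UNIV_I)
    then show ?thesis
      using that const by blast
  qed
  \<comment> \<open>Seven equal diagonal entries add up to the trace, whose integrand is constant by
    orthogonality.\<close>
  have "7 * M 1 = (\<Sum>i\<in>UNIV - {0::8}. M 1)"
    by simp
  also have "\<dots> = (\<Sum>i\<in>UNIV - {0}. M i)"
    by (intro sum.cong refl M[symmetric]) simp
  also have "\<dots> = (\<integral>g. (\<Sum>i\<in>UNIV - {0}. coeff2 i i j1 j2 g) \<partial>\<mu>)"
    unfolding M_def by (simp add: coeff2_integrable[OF haar j])
  also have "\<dots> = (\<integral>g. e j1 \<bullet> e j2 \<partial>\<mu>)"
  proof (intro Bochner_Integration.integral_cong refl)
    fix g assume "g \<in> space \<mu>"
    then have g: "g \<in> G2"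
      using haar by (simp add: normalized_haar_measure_def)
    \<comment> \<open>The term of index 0 can be added because \<open>g\<close> maps
      \<open>e j1\<close> into \<open>V\<close>.\<close>
    have "(\<Sum>i\<in>UNIV - {0}. coeff2 i i j1 j2 g) = (\<Sum>i\<in>UNIV. coeff2 i i j1 j2 g)"
      using G2_nth_0[OF g, of "e j1"] j by (simp add: sum.remove[of UNIV 0] coeff2_def e_nth)
    also have "\<dots> = blinfun_apply g (e j1) \<bullet> blinfun_apply g (e j2)"
      by (simp add: coeff2_def inner_vec_def)
    finally show "(\<Sum>i\<in>UNIV - {0}. coeff2 i i j1 j2 g) = e j1 \<bullet> e j2"
      using j by (simp add: G2_inner[OF g] e_nth)
  qed
  also have "\<dots> = (if j1 = j2 then 1 else 0)"
    using haar by (simp add: normalized_haar_measure_def measure_def e_def inner_axis_axis)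
  finally show ?thesis
    using M[OF i] by (simp add: M_def)
qed

lemma has_bochner_integral_coeff2:
  assumes haar: "normalized_haar_measure G2 (o\<^sub>L) \<mu>"
    and "i1 \<noteq> 0" "i2 \<noteq> 0" "j1 \<noteq> 0" "j2 \<noteq> 0"
  shows "has_bochner_integral \<mu> (\<lambda>g. rho g (e j1) $ i1 * rho g (e j2) $ i2)
    (1/7 * (if i1 = i2 then 1 else 0) * (if j1 = j2 then 1 else 0))"
proof -
  have "integral\<^sup>L \<mu> (coeff2 i1 i2 j1 j2) =
      1/7 * (if i1 = i2 then 1 else 0) * (if j1 = j2 then 1 else 0)"
    using integral_coeff2_off_diagonal[OF haar assms(2,3)]
      integral_coeff2_diagonal[OF haar assms(2,4,5)]
    by (cases "i1 = i2") simp_all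
  then have "has_bochner_integral \<mu> (coeff2 i1 i2 j1 j2)
      (1/7 * (if i1 = i2 then 1 else 0) * (if j1 = j2 then 1 else 0))"
    using coeff2_integrable[OF haar assms(4,5)] by (simp add: has_bochner_integral_iff)
  \<comment> \<open>On \<open>V\<close> the restriction \<open>rho g\<close> agrees with
    \<open>g\<close>, so \<open>coeff2\<close> is the required integrand.\<close>
  moreover have "e j1 \<in> V" "e j2 \<in> V"
    using assms by (simp_all add: V_def tau_O_def e_nth)
  ultimately show ?thesis
    by (simp add: rho_def coeff2_def[abs_def])
qed


section \<open>The Weingarten map\<close>

text \<open>Since \<open>B\<close> is the Kronecker delta on the basis, the induced product is the
  standard one on coordinates.\<close>

lemma VV_inner_eq: "VV_inner S T = S \<bullet> T"
proof -
  have "VV_inner S T = (\<Sum>i\<in>UNIV. \<Sum>j\<in>UNIV. \<Sum>k\<in>UNIV. \<Sum>l\<in>UNIV.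
      if l = j then (if k = i then S $ (i, j) * T $ (k, l) else 0) else 0)"
    unfolding VV_inner_def B_basis by (intro sum.cong refl) auto
  also have "\<dots> = (\<Sum>i\<in>UNIV. \<Sum>j\<in>UNIV. S $ (i, j) * T $ (i, j))"
    by simp
  also have "\<dots> = S \<bullet> T"
    by (simp add: inner_vec_def sum.cartesian_product)
  finally show ?thesis .
qed

lemma u_inner_basis: "u \<bullet> (e i \<otimes> e j) = (if i = j \<and> i \<noteq> 0 then 1 else 0)"
proof -
  have "u \<bullet> (e i \<otimes> e j) = u $ (i, j)"
    by (simp add: e_tensor_e inner_axis)
  also have "\<dots> = (\<Sum>k\<in>UNIV - {0}. e k $ i * e k $ j)"
    by (simp add: u_def tensor_def)
  also have "\<dots> = (\<Sum>k\<in>UNIV - {0}. if k = i then (if i = j then 1 else 0) else 0)"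
    by (intro sum.cong refl) (auto simp: e_nth)
  also have "\<dots> = (if i = j \<and> i \<noteq> 0 then 1 else 0)"
    by (simp add: sum.delta)
  finally show ?thesis .
qed

lemma u_inner_u: "u \<bullet> u = 7"
proof -
  have "u \<bullet> u = (\<Sum>k\<in>UNIV - {0}. u \<bullet> (e k \<otimes> e k))"
    by (subst (2) u_def) (simp add: inner_sum_right)
  then show ?thesis
    by (simp add: u_inner_basis)
qed

lemma u_nonzero: "u \<noteq> 0"
  using u_inner_u by auto

section \<open>The adjoint of the inclusion of A\<close>

lemma A_eq: "A = range (\<lambda>s. s *\<^sub>R u)"
  by (simp add: A_def span_singleton)

text \<open>As \<open>u\<close> is nonzero, the two scalars are determined by the vectors, so the
  description in \<open>A_inner\<close> is unique.\<close>

lemma A_inner_scaled: "A_inner (s *\<^sub>R u) (t *\<^sub>R u) = s * t"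
  unfolding A_inner_def using u_nonzero by (intro the_equality) auto

lemma tau_star_eq:
  assumes "y \<in> VV"
  shows "tau_star y = (u \<bullet> y) *\<^sub>R u"
proof -
  have "(THE x'. x' \<in> A \<and> (\<forall>x\<in>A. VV_inner (tau x) y = A_inner x x')) = (u \<bullet> y) *\<^sub>R u"
  proof (rule the_equality)
    show "(u \<bullet> y) *\<^sub>R u \<in> A \<and> (\<forall>x\<in>A. VV_inner (tau x) y = A_inner x ((u \<bullet> y) *\<^sub>R u))"
      by (auto simp: A_eq tau_def VV_inner_eq A_inner_scaled)
  next
    fix x' assume x': "x' \<in> A \<and> (\<forall>x\<in>A. VV_inner (tau x) y = A_inner x x')"
    then obtain t where t: "x' = t *\<^sub>R u" by (auto simp: A_eq)
    \<comment> \<open>Testing the adjoint equation at \<open>u\<close>, which has norm 1 for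
      \<open>A_inner\<close>, fixes the scalar \<open>t\<close>.\<close>
    have "u = 1 *\<^sub>R u" and "u \<in> A" by (simp_all add: A_def span_base)
    then have "u \<bullet> y = A_inner (1 *\<^sub>R u) x'"
      using x' by (simp add: tau_def VV_inner_eq)
    then show "x' = (u \<bullet> y) *\<^sub>R u"
      unfolding t A_inner_scaled by simp
  qed
  then show ?thesis
    using assms by (simp add: tau_star_def adjoint_on_def)
qed

lemma A_subset_VV: "A \<subseteq> VV"
  unfolding A_def using u_in_VV by (intro span_minimal) (auto simp: VV_def)

text \<open>The factor 7 compares the two inner products: \<open>u\<close> has squared norm 7 in the
  tensor product but 1 in \<open>A\<close>.\<close>

lemma tau_star_tau:
  assumes "a \<in> A"
  shows "(tau_star \<circ> tau) a = 7 *\<^sub>R a"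
proof -
  obtain s where "a = s *\<^sub>R u" using assms by (auto simp: A_eq)
  then show ?thesis
    using assms A_subset_VV by (auto simp: tau_def tau_star_eq u_inner_u)
qed

text \<open>A nonzero scaling is invertible, and the identity f g f = f together with homogeneity of
  g already forces g to be its inverse.\<close>

lemma moore_penrose_scaleR:
  fixes X :: "'a::real_vector set"
  assumes X: "subspace X" and c: "c \<noteq> 0" and f: "\<And>x. x \<in> X \<Longrightarrow> f x = c *\<^sub>R x"
    and p: "\<And>x y. x \<in> X \<Longrightarrow> y \<in> X \<Longrightarrow> p (c *\<^sub>R (inverse c *\<^sub>R x)) y = p x (c *\<^sub>R (inverse c *\<^sub>R y))"
  shows "moore_penrose X p f = (\<lambda>x\<in>X. inverse c *\<^sub>R x)"
  unfolding moore_penrose_def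
proof (rule the_equality)
  show "is_moore_penrose X p f (\<lambda>x\<in>X. inverse c *\<^sub>R x)"
    using X c
    by (auto simp: is_moore_penrose_def selfadjoint_on_def f subspace_add subspace_scale
        scaleR_add_right PiE_iff)
next
  fix g assume g: "is_moore_penrose X p f g"
  show "g = (\<lambda>x\<in>X. inverse c *\<^sub>R x)"
  proof
    fix x
    show "g x = (\<lambda>x\<in>X. inverse c *\<^sub>R x) x"
    proof (cases "x \<in> X")
      case True
      then have gx: "g x \<in> X" and "g (c *\<^sub>R x) = c *\<^sub>R g x" and "f (g (f x)) = f x"
        using g by (auto simp: is_moore_penrose_def)
      then have "c *\<^sub>R (c *\<^sub>R g x) = c *\<^sub>R x"
        using True X by (simp add: f subspace_scale)
      then have "c *\<^sub>R g x = x"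
        using c by (metis scaleR_left_imp_eq)
      then show ?thesis
        using True c by (metis restrict_apply' scaleR_left_imp_eq scaleR_scaleR
            right_inverse scaleR_one)
    next
      \<comment> \<open>Outside \<open>X\<close> both maps take the default value of extensional
        functions.\<close>
      case False
      then show ?thesis
        using g by (auto simp: is_moore_penrose_def PiE_def extensional_def)
    qed
  qed
qed

lemma Wg_eq: "a \<in> A \<Longrightarrow> Wg a = (1/7) *\<^sub>R a"
  using moore_penrose_scaleR[of A 7 "tau_star \<circ> tau" A_inner] tau_star_tau
  by (simp add: Wg_def A_def inverse_eq_divide)

lemma tau_Wg_tau_star_basis:
  assumes "i \<noteq> 0" "j \<noteq> 0"
  shows "(tau \<circ> Wg \<circ> tau_star) (e i \<otimes> e j) = (1/7 * (if i = j then 1 else 0)) *\<^sub>R u"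
proof -
  have "e i \<in> V" "e j \<in> V"
    using assms by (simp_all add: V_def tau_O_def e_nth)
  then have "e i \<otimes> e j \<in> VV"
    unfolding VV_def by (intro span_base) blast
  then have star: "tau_star (e i \<otimes> e j) = (if i = j then 1 else 0) *\<^sub>R u"
    using assms by (simp add: tau_star_eq u_inner_basis)
  have "c *\<^sub>R u \<in> A" for c
    by (simp add: A_def span_scale span_base)
  then show ?thesis
    by (simp add: star Wg_eq tau_def)
qed

section \<open>Integration of tensor-valued functions\<close>

lemma has_bochner_integral_vec:
  fixes f :: "'a \<Rightarrow> real ^ 'n"
  assumes "\<And>i. has_bochner_integral M (\<lambda>x. f x $ i) (c $ i)"
  shows "has_bochner_integral M f c"
proof -
  have expand: "v = (\<Sum>i\<in>UNIV. v $ i *\<^sub>R axis i 1)" for v :: "real ^ 'n"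
    using basis_expansion[of v] by (simp add: scalar_mult_eq_scaleR)
  have "has_bochner_integral M (\<lambda>x. \<Sum>i\<in>UNIV. f x $ i *\<^sub>R axis i (1::real))
      (\<Sum>i\<in>UNIV. c $ i *\<^sub>R axis i 1)"
    by (intro has_bochner_integral_sum has_bochner_integral_scaleR_left assms)
  then show ?thesis
    using expand by simp
qed

text \<open>Each coordinate of the integrand is a product of two matrix coefficients, so the scalar
  integrals determine the tensor.\<close>

lemma has_bochner_integral_tensor_square:
  assumes haar: "normalized_haar_measure G2 (o\<^sub>L) \<mu>" and "i \<noteq> 0" "j \<noteq> 0"
  shows "has_bochner_integral \<mu> (\<lambda>g. tensor_square (rho g) (e i \<otimes> e j))
    ((1/7 * (if i = j then 1 else 0)) *\<^sub>R u)"
proof (rule has_bochner_integral_vec)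
  fix p :: "8 \<times> 8"
  obtain a b where p: "p = (a, b)" by (cases p)
  have V: "e i \<in> V" "e j \<in> V"
    using assms by (simp_all add: V_def tau_O_def e_nth)
  have "has_bochner_integral \<mu> (\<lambda>g. rho g (e i) $ a * rho g (e j) $ b)
      (1/7 * (if i = j then 1 else 0) * u $ p)"
  \<comment> \<open>Coordinates with an index 0 lie outside the scalar formula; there the integrand
    vanishes because \<open>rho g\<close> preserves \<open>V\<close>.\<close>
  proof (cases "a = 0 \<or> b = 0")
    case True
    have z: "g \<in> space \<mu> \<Longrightarrow> rho g (e i) $ a * rho g (e j) $ b = 0" for g
      using haar True rho_in_V[OF _ V(1)] rho_in_V[OF _ V(2)]
      by (auto simp: normalized_haar_measure_def V_def tau_O_def)
    have "has_bochner_integral \<mu> (\<lambda>g. rho g (e i) $ a * rho g (e j) $ b) 0"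
      by (subst has_bochner_integral_cong[OF refl z refl]) (simp_all add: has_bochner_integral_zero)
    moreover have "u $ p = 0"
      using u_inner_basis[of a b] True by (auto simp: p e_tensor_e inner_axis)
    ultimately show ?thesis by simp
  next
    case False
    moreover from False have "u $ p = (if a = b then 1 else 0)"
      using u_inner_basis[of a b] by (simp add: p e_tensor_e inner_axis)
    ultimately show ?thesis
      using has_bochner_integral_coeff2[OF haar, of a b i j] assms(2,3) by (simp add: mult_ac)
  qed
  \<comment> \<open>Points of the measure space lie in \<open>G2\<close>, where the tensor square
    acts factor by factor.\<close>
  moreover have "g \<in> space \<mu> \<Longrightarrow>
      tensor_square (rho g) (e i \<otimes> e j) $ p = rho g (e i) $ a * rho g (e j) $ b" for g
    using haar tensor_square_tensor[OF _ V, of g]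
    by (simp only: normalized_haar_measure_def) (simp add: tensor_def p)
  ultimately show "has_bochner_integral \<mu> (\<lambda>g. tensor_square (rho g) (e i \<otimes> e j) $ p)
      (((1/7 * (if i = j then 1 else 0)) *\<^sub>R u) $ p)"
    by (simp cong: has_bochner_integral_cong)
qed

theorem mainTheorem9:
  fixes \<mu> :: "(octonion \<Rightarrow>\<^sub>L octonion) measure"
  assumes haar: "normalized_haar_measure G2 (o\<^sub>L) \<mu>"
  shows "(\<forall>a\<in>A. (tau_star \<circ> tau) a = 7 *\<^sub>R a) \<and>
    (\<forall>a\<in>A. Wg a = (1/7) *\<^sub>R a) \<and>
    (\<forall>i j. i \<noteq> 0 \<longrightarrow> j \<noteq> 0 \<longrightarrow>
       has_bochner_integral \<mu> (\<lambda>g. tensor_square (rho g) (e i \<otimes> e j))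
         ((tau \<circ> Wg \<circ> tau_star) (e i \<otimes> e j)) \<and>
       (tau \<circ> Wg \<circ> tau_star) (e i \<otimes> e j) =
         (1/7 * (if i = j then 1 else 0)) *\<^sub>R (\<Sum>k\<in>UNIV - {0}. e k \<otimes> e k)) \<and>
    (\<forall>i1 i2 j1 j2. i1 \<noteq> 0 \<longrightarrow> i2 \<noteq> 0 \<longrightarrow> j1 \<noteq> 0 \<longrightarrow> j2 \<noteq> 0 \<longrightarrow>
       has_bochner_integral \<mu> (\<lambda>g. rho g (e j1) $ i1 * rho g (e j2) $ i2)
         (1/7 * (if i1 = i2 then 1 else 0) * (if j1 = j2 then 1 else 0)))"
  unfolding u_def[symmetric]
proof (intro conjI ballI allI impI)
  fix i j :: 8 assume ij: "i \<noteq> 0" "j \<noteq> 0"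
  show "(tau \<circ> Wg \<circ> tau_star) (e i \<otimes> e j) = (1/7 * (if i = j then 1 else 0)) *\<^sub>R u"
    using ij by (rule tau_Wg_tau_star_basis)
  then show "has_bochner_integral \<mu> (\<lambda>g. tensor_square (rho g) (e i \<otimes> e j))
      ((tau \<circ> Wg \<circ> tau_star) (e i \<otimes> e j))"
    using has_bochner_integral_tensor_square[OF haar ij] by simp
qed (rule tau_star_tau Wg_eq has_bochner_integral_coeff2[OF haar]; assumption)+

end
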